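(* Let $p_A(x)=\det(xI-A)$ denote the characteristic polynomial of $A \in \mathrm{H}_n(\mathbb{C})$. For $d\geq 2$ even, $|\!|\!| A |\!|\!|_d^d$ is the $d$th coefficient (the coefficient of $x^d$) in the Taylor expansion of $$\frac{1}{\det(I - x A)} = \frac{1}{ x^n p_A(1/x)}$$ about the origin.
   Context: $\mathrm{H}_n(\mathbb{C})$ is the set of $n\times n$ complex Hermitian matrices. For $A\in\mathrm{H}_n(\mathbb{C})$ with eigenvalues $\lambda_1(A)\ge\cdots\ge\lambda_n(A)$ (with multiplicity) and $d\ge2$ even, $$|\!|\!| A |\!|\!|_{d}=\big(h_d(\lambda_1(A),\ldots,\lambda_n(A))\big)^{1/d},\qquad h_d(x_1,\ldots,x_n)=\sum_{1\le i_1\le\cdots\le i_d\le n}x_{i_1}\cdots x_{i_d}.$$ (Here $h_d\ge0$ on $\mathbb{R}^n$ for $d$ even.) The apparent singularity of $1/(x^np_A(1/x))$ at the origin is removable. *)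

theory Defs
  imports
    "HOL-Complex_Analysis.Complex_Analysis"
    "Jordan_Normal_Form.Char_Poly"
    "Jordan_Normal_Form.Schur_Decomposition"
begin

definition hermitian_mats :: "nat \<Rightarrow> complex mat set" where
  "hermitian_mats n = {A \<in> carrier_mat n n. mat_adjoint A = A}"

(* Eigenvalues with algebraic multiplicity in weakly decreasing order. Meant for Hermitian A,
   whose eigenvalues are real, so that Re only changes the type. *)
definition eigvals_desc :: "complex mat \<Rightarrow> real list" where
  "eigvals_desc A = rev (sorted_list_of_multiset (image_mset Re (proots (char_poly A))))"

(* js ranges over the index sequences i_1 <= ... <= i_d, with indices starting at 0. *)
definition chs :: "nat \<Rightarrow> real list \<Rightarrow> real" where
  "chs d xs = (\<Sum>js | length js = d \<and> sorted js \<and> set js \<subseteq> {..<length xs}. \<Prod>j\<leftarrow>js. xs ! j)"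

lemma finite_chs_indices: "finite {js. length js = d \<and> sorted js \<and> set js \<subseteq> {..<n::nat}}"
  by (rule finite_subset[OF _ finite_lists_length_eq[of "{..<n}" d]]) auto

definition chs_norm :: "nat \<Rightarrow> complex mat \<Rightarrow> real" where
  "chs_norm d A = root d (chs d (eigvals_desc A))"

end

theory Submission
  imports Defs
begin

text \<open>
  Hermitian matrices have real eigenvalues \<open>x\<^sub>1, \<dots>, x\<^sub>n\<close>, so
  \<open>det (I - z A) = (1 - x\<^sub>1 z) \<dots> (1 - x\<^sub>n z)\<close>; the reciprocal of this product is a product
  of geometric series, and its coefficient at \<open>z\<^sup>d\<close> collects all monomials of degree \<open>d\<close> in the
  \<open>x\<^sub>i\<close>, which is \<open>h\<^sub>d(x\<^sub>1, \<dots>, x\<^sub>n)\<close>. Formally, the recursion \<open>chs_snoc\<close> says that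
  appending \<open>x\<close> to the list of variables divides the generating series by \<open>1 - x X\<close>
  (\<open>chs_generating_function\<close>), and \<open>det_one_minus_smult_eigvals\<close> factorizes the determinant.

  Since the norm is a \<open>d\<close>-th root, its \<open>d\<close>-th power is \<open>h\<^sub>d\<close> only if \<open>h\<^sub>d \<ge> 0\<close>: the \<open>d\<close>-th
  power of the \<open>d\<close>-th root of a negative number would be its absolute value when \<open>d\<close> is even. This
  positivity (\<open>chs_nonneg_even\<close>) is the other half of the proof. The operator
  \<open>(1 - x D)\<inverse> = 1 + x D + x\<^sup>2 D\<^sup>2 + \<dots>\<close> on real polynomials, where \<open>D\<close> is differentiation, maps
  nonnegative polynomials to nonnegative ones: if \<open>q - x q'\<close> is nonnegative, then at a global
  minimum of \<open>q\<close> the derivative vanishes, so that the minimal value of \<open>q\<close> is a value of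
  \<open>q - x q'\<close>. Applying these operators for \<open>x\<^sub>1, \<dots>, x\<^sub>n\<close> to \<open>t\<^sup>d / d!\<close> yields
  \<open>\<Sum>\<^sub>j h\<^sub>j t\<^sup>d\<^sup>-\<^sup>j / (d - j)!\<close>, whose value at \<open>0\<close> is \<open>h\<^sub>d\<close>.
\<close>

section \<open>Complete homogeneous symmetric polynomials\<close>

lemma chs_0: "chs 0 xs = 1"
proof -
  have "{js. length js = 0 \<and> sorted js \<and> set js \<subseteq> {..<length xs}} = {[]}"
    by auto
  then show ?thesis
    by (simp add: chs_def)
qed

lemma chs_Suc_Nil: "chs (Suc d) [] = 0"
proof -
  have "{js::nat list. length js = Suc d \<and> sorted js \<and> set js \<subseteq> {..<length ([]::real list)}} = {}"
    by auto
  then show ?thesis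
    unfolding chs_def by (simp only: sum.empty)
qed

text \<open>A weakly increasing index sequence either avoids the largest index or ends with it.\<close>

lemma chs_snoc: "chs (Suc d) (xs @ [x]) = chs (Suc d) xs + x * chs d (xs @ [x])"
proof -
  define S where "S = (\<lambda>k m. {js::nat list. length js = k \<and> sorted js \<and> set js \<subseteq> {..<m}})"
  define n where "n = length xs"
  have fin: "finite (S k m)" for k m
    unfolding S_def by (rule finite_chs_indices)
  have split: "S (Suc d) (Suc n) = S (Suc d) n \<union> (\<lambda>js. js @ [n]) ` S d (Suc n)"
  proof (intro equalityI subsetI)
    fix js assume js: "js \<in> S (Suc d) (Suc n)"
    then have "js \<noteq> []" by (auto simp: S_def)
    then obtain ks k where jk: "js = ks @ [k]" by (metis append_butlast_last_id)
    show "js \<in> S (Suc d) n \<union> (\<lambda>js. js @ [n]) ` S d (Suc n)"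
    proof (cases "k = n")
      case True
      then show ?thesis using js jk by (auto simp: S_def sorted_append)
    next
      case False
      then have "js \<in> S (Suc d) n"
        using js jk by (fastforce simp: S_def sorted_append)
      then show ?thesis by simp
    qed
  next
    fix js assume "js \<in> S (Suc d) n \<union> (\<lambda>js. js @ [n]) ` S d (Suc n)"
    then show "js \<in> S (Suc d) (Suc n)"
      by (fastforce simp: S_def sorted_append)
  qed
  have disj: "S (Suc d) n \<inter> (\<lambda>js. js @ [n]) ` S d (Suc n) = {}"
    by (auto simp: S_def)
  have inj: "inj_on (\<lambda>js. js @ [n]) (S d (Suc n))"
    by (auto simp: inj_on_def)
  have nth: "(\<Prod>j\<leftarrow>js. (xs @ [x]) ! j) = (\<Prod>j\<leftarrow>js. xs ! j)" if "js \<in> S (Suc d) n" for js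
    using that
    by (intro arg_cong[where f = prod_list] map_cong) (auto simp: S_def n_def nth_append)
  have "chs (Suc d) (xs @ [x]) = (\<Sum>js\<in>S (Suc d) (Suc n). \<Prod>j\<leftarrow>js. (xs @ [x]) ! j)"
    by (simp add: chs_def S_def n_def)
  also have "\<dots> = (\<Sum>js\<in>S (Suc d) n. \<Prod>j\<leftarrow>js. (xs @ [x]) ! j)
      + (\<Sum>js\<in>S d (Suc n). \<Prod>j\<leftarrow>js @ [n]. (xs @ [x]) ! j)"
    unfolding split using fin disj inj
    by (subst sum.union_disjoint) (auto simp: sum.reindex)
  also have "(\<Sum>js\<in>S (Suc d) n. \<Prod>j\<leftarrow>js. (xs @ [x]) ! j) = chs (Suc d) xs"
    using nth by (simp add: chs_def S_def n_def)
  also have "(\<Sum>js\<in>S d (Suc n). \<Prod>j\<leftarrow>js @ [n]. (xs @ [x]) ! j) = x * chs d (xs @ [x])"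
    by (simp add: chs_def S_def n_def sum_distrib_left mult.commute)
  finally show ?thesis .
qed

definition chs_fps :: "real list \<Rightarrow> complex fps" where
  "chs_fps xs = Abs_fps (\<lambda>d. complex_of_real (chs d xs))"

lemma chs_fps_snoc: "(1 - fps_const (complex_of_real x) * fps_X) * chs_fps (xs @ [x]) = chs_fps xs"
proof (rule fps_ext)
  fix d
  show "fps_nth ((1 - fps_const (complex_of_real x) * fps_X) * chs_fps (xs @ [x])) d
      = fps_nth (chs_fps xs) d"
    by (cases d) (simp_all add: chs_fps_def algebra_simps chs_0 chs_snoc)
qed

lemma chs_generating_function:
  "(\<Prod>x\<leftarrow>xs. 1 - fps_const (complex_of_real x) * fps_X) * chs_fps xs = 1"
proof (induction xs rule: rev_induct)
  case Nil
  have "chs_fps [] = 1"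
  proof (rule fps_ext)
    fix d show "fps_nth (chs_fps []) d = fps_nth 1 d"
      by (cases d) (simp_all add: chs_fps_def chs_0 chs_Suc_Nil)
  qed
  then show ?case by simp
next
  case (snoc x xs)
  then show ?case by (simp add: mult.assoc chs_fps_snoc)
qed

text \<open>
  The formal identity transfers to functions because each linear factor has constant term \<open>1\<close>, so
  that the product is invertible both as a power series and near \<open>0\<close>.
\<close>

lemma has_fps_expansion_inverse_linear_factors:
  "(\<lambda>z. 1 / (\<Prod>x\<leftarrow>xs. 1 - complex_of_real x * z)) has_fps_expansion chs_fps xs"
proof -
  define P where "P = (\<Prod>x\<leftarrow>xs. 1 - fps_const (complex_of_real x) * fps_X)"
  have "(\<lambda>z. \<Prod>x\<leftarrow>xs. 1 - complex_of_real x * z) has_fps_expansion P"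
    unfolding P_def by (induction xs) (auto intro!: fps_expansion_intros)
  moreover have "fps_nth P 0 = 1"
    unfolding P_def by (induction xs) auto
  ultimately have "(\<lambda>z. inverse (\<Prod>x\<leftarrow>xs. 1 - complex_of_real x * z)) has_fps_expansion inverse P"
    by (intro has_fps_expansion_inverse) auto
  moreover have "inverse P = chs_fps xs"
    using chs_generating_function[of xs] by (simp add: P_def fps_inverse_unique)
  ultimately show ?thesis
    by (simp add: inverse_eq_divide)
qed

section \<open>Positivity in even degree\<close>

text \<open>
  Positive leading coefficient and even degree make \<open>q\<close> positive far out on both sides, so if \<open>q\<close>
  had a negative value, it would attain its global minimum at an interior point of a large interval;
  there the hypothesis reads \<open>q \<ge> 0\<close> because the derivative vanishes.
\<close>

lemma poly_nonneg_if_minus_pderiv_nonneg: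
  fixes q :: "real poly"
  assumes lc: "lead_coeff q > 0" and ev: "even (Polynomial.degree q)"
    and nonneg: "\<And>t. poly (q - Polynomial.smult x (pderiv q)) t \<ge> 0"
  shows "poly q t \<ge> 0"
proof -
  \<comment> \<open>The reflection \<open>t \<mapsto> q (- t)\<close> reduces the behaviour at \<open>-\<infinity>\<close> to that at \<open>\<infinity>\<close>.\<close>
  let ?r = "pcompose q [:0, -1:]"
  have "lead_coeff ?r = lead_coeff q"
    using ev by (subst lead_coeff_comp) auto
  then obtain M N where M: "\<And>t. t \<ge> M \<Longrightarrow> poly q t \<ge> lead_coeff q"
    and N: "\<And>t. t \<ge> N \<Longrightarrow> poly ?r t \<ge> lead_coeff q"
    using poly_pinfty_gt_lc[of q] poly_pinfty_gt_lc[of ?r] lc by metis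
  define B where "B = max (max M N) (max 0 \<bar>t\<bar>)"
  then have "B \<ge> 0" by simp
  have outside: "poly q u > 0" if "\<bar>u\<bar> \<ge> B" for u
  proof (cases "u \<ge> 0")
    case True
    then have "u \<ge> M" using that by (auto simp: B_def)
    then show ?thesis using M[of u] lc by linarith
  next
    case False
    then have "- u \<ge> N" using that by (auto simp: B_def)
    then show ?thesis using N[of "- u"] lc by (simp add: poly_pcompose)
  qed
  have "continuous_on {-B..B} (poly q)"
    by (intro continuous_intros)
  then obtain s where s: "s \<in> {-B..B}" and min: "\<And>u. u \<in> {-B..B} \<Longrightarrow> poly q s \<le> poly q u"
    using continuous_attains_inf[of "{-B..B}" "poly q"] \<open>B \<ge> 0\<close> by auto
  have t: "t \<in> {-B..B}" by (auto simp: B_def)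
  show ?thesis
  proof (cases "\<bar>s\<bar> = B")
    case True
    then show ?thesis using outside[of s] min[OF t] by simp
  next
    case False
    with s have "\<bar>s\<bar> < B" by auto
    then have "\<forall>y. \<bar>s - y\<bar> < B - \<bar>s\<bar> \<longrightarrow> poly q s \<le> poly q y"
      by (auto intro!: min)
    then have "poly (pderiv q) s = 0"
      using DERIV_local_min[OF poly_DERIV, of "B - \<bar>s\<bar>" s q] \<open>\<bar>s\<bar> < B\<close> by auto
    then have "poly q s \<ge> 0" using nonneg[of s] by simp
    then show ?thesis using min[OF t] by simp
  qed
qed

text \<open>
  This is \<open>\<Sum>\<^sub>j h\<^sub>j t\<^sup>d\<^sup>-\<^sup>j / (d - j)!\<close> with \<open>j = d - i\<close>, the image of \<open>t\<^sup>d / d!\<close> under the product of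
  the operators \<open>(1 - x D)\<inverse>\<close> over all entries \<open>x\<close> of the list.
\<close>

definition chs_poly :: "nat \<Rightarrow> real list \<Rightarrow> real poly" where
  "chs_poly d xs = (\<Sum>i\<le>d. Polynomial.monom (chs (d - i) xs / fact i) i)"

lemma coeff_chs_poly: "Polynomial.coeff (chs_poly d xs) i = (if i \<le> d then chs (d - i) xs / fact i else 0)"
proof -
  have "Polynomial.coeff (chs_poly d xs) i = (\<Sum>j\<le>d. if j = i then chs (d - j) xs / fact j else 0)"
    unfolding chs_poly_def Polynomial.coeff_sum Polynomial.coeff_monom ..
  also have "\<dots> = (if i \<in> {..d} then chs (d - i) xs / fact i else 0)"
    by (rule sum.delta) simp
  finally show ?thesis by simp
qed

lemma degree_chs_poly: "Polynomial.degree (chs_poly d xs) = d"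
proof (rule antisym)
  show "Polynomial.degree (chs_poly d xs) \<le> d"
    by (rule Polynomial.degree_le) (simp add: coeff_chs_poly)
  show "d \<le> Polynomial.degree (chs_poly d xs)"
    by (rule Polynomial.le_degree) (simp add: coeff_chs_poly chs_0)
qed

text \<open>
  Differentiation shifts the factorials by one, which turns \<open>chs_snoc\<close> into an identity of
  polynomials: one more variable \<open>x\<close> amounts to applying \<open>(1 - x D)\<inverse>\<close>.
\<close>

lemma chs_poly_snoc:
  "chs_poly d (xs @ [x]) - Polynomial.smult x (pderiv (chs_poly d (xs @ [x]))) = chs_poly d xs"
proof (rule poly_eqI)
  fix i
  have *: "chs (d - i) (xs @ [x]) = chs (d - i) xs + x * chs (d - Suc i) (xs @ [x])" if "i < d"
    using chs_snoc[of "d - Suc i" xs x] that by (simp add: Suc_diff_Suc)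
  show "Polynomial.coeff (chs_poly d (xs @ [x]) - Polynomial.smult x (pderiv (chs_poly d (xs @ [x])))) i
      = Polynomial.coeff (chs_poly d xs) i"
    by (cases "i < d"; cases "i = d")
       (auto simp: coeff_pderiv coeff_chs_poly chs_0 * field_simps simp del: of_nat_Suc)
qed

text \<open>
  Nonnegativity on the whole line, rather than only at \<open>0\<close>, is what the induction over the
  variables needs: the minimum of the new polynomial can lie anywhere.
\<close>

lemma chs_poly_nonneg:
  assumes "even d"
  shows "poly (chs_poly d xs) t \<ge> 0"
proof (induction xs arbitrary: t rule: rev_induct)
  case Nil
  have "chs_poly d [] = Polynomial.monom (1 / fact d) d"
  proof (rule poly_eqI)
    fix i
    show "Polynomial.coeff (chs_poly d []) i = Polynomial.coeff (Polynomial.monom (1 / fact d) d) i"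
      by (cases "d - i") (auto simp: coeff_chs_poly chs_0 chs_Suc_Nil)
  qed
  then show ?case using assms by (simp add: poly_monom zero_le_even_power)
next
  case (snoc x xs)
  show ?case
  proof (rule poly_nonneg_if_minus_pderiv_nonneg)
    show "lead_coeff (chs_poly d (xs @ [x])) > 0"
      by (simp only: degree_chs_poly coeff_chs_poly) (simp add: chs_0)
    show "even (Polynomial.degree (chs_poly d (xs @ [x])))"
      using assms by (simp add: degree_chs_poly)
    show "poly (chs_poly d (xs @ [x]) - Polynomial.smult x (pderiv (chs_poly d (xs @ [x])))) t \<ge> 0" for t
      unfolding chs_poly_snoc by (rule snoc.IH)
  qed
qed

lemma chs_nonneg_even:
  assumes "even d"
  shows "chs d xs \<ge> 0"
proof -
  have "poly (chs_poly d xs) 0 = chs d xs"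
    by (simp only: poly_0_coeff_0 coeff_chs_poly) simp
  then show ?thesis
    using chs_poly_nonneg[OF assms, of xs 0] by simp
qed

section \<open>The reversed characteristic polynomial\<close>

lemma det_one_minus_smult:
  fixes A :: "'a::field mat"
  assumes A: "A \<in> carrier_mat n n" and x: "x \<noteq> 0"
  shows "Determinant.det (1\<^sub>m n - x \<cdot>\<^sub>m A) = x ^ n * poly (char_poly A) (1 / x)"
proof -
  have "1\<^sub>m n - x \<cdot>\<^sub>m A = x \<cdot>\<^sub>m (- char_matrix A (1 / x))"
    using A x by (intro eq_matI) (auto simp: char_matrix_def field_simps)
  then show ?thesis
    using A by (simp add: char_poly_matrix[OF A] char_matrix_def)
qed

lemma det_one_minus_smult_proots:
  fixes A :: "complex mat"
  assumes A: "A \<in> carrier_mat n n"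
  shows "Determinant.det (1\<^sub>m n - z \<cdot>\<^sub>m A) = (\<Prod>l\<in>#proots (char_poly A). 1 - l * z)"
proof (cases "z = 0")
  case True
  have "1\<^sub>m n - 0 \<cdot>\<^sub>m A = 1\<^sub>m n"
    using A by (intro eq_matI) auto
  then show ?thesis using True by simp
next
  case False
  have deg: "Polynomial.degree (char_poly A) = n" and monic: "lead_coeff (char_poly A) = 1"
    using degree_monic_char_poly[OF A] by auto
  have decomp: "char_poly A = (\<Prod>l\<in>#proots (char_poly A). [:-l, 1:])"
    using complex_poly_decompose_multiset[of "char_poly A"] monic by simp
  \<comment> \<open>Each of the \<open>n\<close> factors \<open>z\<close> is absorbed by one linear factor: \<open>z (1 / z - l) = 1 - l z\<close>.\<close>
  have scale: "z ^ size L * poly (\<Prod>l\<in>#L. [:-l, 1:]) (1 / z) = (\<Prod>l\<in>#L. 1 - l * z)" for L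
    using False by (induction L) (simp_all add: field_simps)
  have "size (proots (char_poly A)) = n"
    using deg by (simp add: size_proots_complex)
  then show ?thesis
    using det_one_minus_smult[OF A False] scale[of "proots (char_poly A)"] decomp by metis
qed

lemma hermitian_entry:
  assumes "A \<in> hermitian_mats n" "i < n" "j < n"
  shows "A $$ (j, i) = cnj (A $$ (i, j))"
proof -
  have A: "A \<in> carrier_mat n n" and adj: "mat_adjoint A = A"
    using assms(1) by (auto simp: hermitian_mats_def)
  have "mat_adjoint A $$ (j, i) = cnj (A $$ (i, j))"
    using A assms(2,3) by (simp add: mat_adjoint_def mat_of_rows_def)
  then show ?thesis using adj by simp
qed

text \<open>
  For an eigenvector \<open>v\<close>, the number \<open>Q = v\<^sup>* A v\<close> is its own conjugate since \<open>A\<close> is Hermitian, and it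
  equals \<open>l\<close> times the nonzero real number \<open>v\<^sup>* v\<close>.
\<close>

lemma hermitian_eigenvalue_real:
  assumes herm: "A \<in> hermitian_mats n" and root: "poly (char_poly A) l = 0"
  shows "l \<in> \<real>"
proof -
  have A: "A \<in> carrier_mat n n"
    using herm by (simp add: hermitian_mats_def)
  obtain v where v: "v \<in> carrier_vec n" "v \<noteq> 0\<^sub>v n" and Av: "A *\<^sub>v v = l \<cdot>\<^sub>v v"
    using root eigenvalue_root_char_poly[OF A, of l] A
    by (auto simp: eigenvalue_def eigenvector_def)
  define w where "w = vec_index v"
  have row: "(\<Sum>j<n. A $$ (i, j) * w j) = l * w i" if "i < n" for i
    using arg_cong[OF Av, of "\<lambda>u. vec_index u i"] that A v(1)
    by (simp add: w_def scalar_prod_def lessThan_atLeast0)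
  define Q where "Q = (\<Sum>i<n. \<Sum>j<n. cnj (w i) * A $$ (i, j) * w j)"
  define N where "N = (\<Sum>i<n. (cmod (w i))\<^sup>2)"
  have "Q = (\<Sum>i<n. cnj (w i) * (l * w i))"
    unfolding Q_def by (intro sum.cong refl) (simp add: row[symmetric] sum_distrib_left mult.assoc)
  also have "\<dots> = l * of_real N"
    by (simp add: N_def sum_distrib_left complex_norm_square mult_ac del: of_real_power)
  finally have Q: "Q = l * of_real N" .
  have "cnj Q = (\<Sum>i<n. \<Sum>j<n. cnj (w j) * A $$ (j, i) * w i)"
    unfolding Q_def cnj_sum
  proof (intro sum.cong refl)
    fix i j assume "i \<in> {..<n}" "j \<in> {..<n}"
    then have "A $$ (j, i) = cnj (A $$ (i, j))"
      using hermitian_entry[OF herm] by blast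
    then show "cnj (cnj (w i) * A $$ (i, j) * w j) = cnj (w j) * A $$ (j, i) * w i"
      by simp
  qed
  also have "\<dots> = Q"
    unfolding Q_def by (rule sum.swap)
  finally have "cnj l * of_real N = l * of_real N"
    by (simp add: Q)
  moreover have "N \<noteq> 0"
  proof
    assume "N = 0"
    then have "w i = 0" if "i < n" for i
      using that by (simp add: N_def sum_nonneg_eq_0_iff)
    then have "v = 0\<^sub>v n"
      using v(1) by (intro eq_vecI) (auto simp: w_def)
    with v(2) show False by simp
  qed
  ultimately show ?thesis
    by (simp add: Reals_cnj_iff)
qed

lemma det_one_minus_smult_eigvals:
  assumes herm: "A \<in> hermitian_mats n"
  shows "Determinant.det (1\<^sub>m n - z \<cdot>\<^sub>m A) = (\<Prod>x\<leftarrow>eigvals_desc A. 1 - complex_of_real x * z)"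
proof -
  have A: "A \<in> carrier_mat n n"
    using herm by (simp add: hermitian_mats_def)
  have "lead_coeff (char_poly A) = 1"
    using degree_monic_char_poly[OF A] by simp
  then have "char_poly A \<noteq> 0" by (metis leading_coeff_0_iff zero_neq_one)
  then have real: "complex_of_real (Re l) = l" if "l \<in># proots (char_poly A)" for l
    using that hermitian_eigenvalue_real[OF herm, of l] by (simp add: set_count_proots)
  have "(\<Prod>x\<leftarrow>eigvals_desc A. 1 - complex_of_real x * z)
      = (\<Prod>x\<in>#mset (eigvals_desc A). 1 - complex_of_real x * z)"
    by (metis mset_map prod_mset_prod_list)
  also have "\<dots> = (\<Prod>l\<in>#proots (char_poly A). 1 - complex_of_real (Re l) * z)"
    by (simp add: eigvals_desc_def image_mset.compositionality o_def)
  also have "\<dots> = (\<Prod>l\<in>#proots (char_poly A). 1 - l * z)"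
    using real by (intro arg_cong[where f = prod_mset] image_mset_cong) simp
  also have "\<dots> = Determinant.det (1\<^sub>m n - z \<cdot>\<^sub>m A)"
    by (rule det_one_minus_smult_proots[OF A, symmetric])
  finally show ?thesis by simp
qed

theorem theorem20:
  fixes A :: "complex mat" and n d :: nat and f g :: "complex \<Rightarrow> complex"
  assumes "A \<in> hermitian_mats n"
    and "even d" and "d \<ge> 2"
  defines "f \<equiv> (\<lambda>x. 1 / Determinant.det (1\<^sub>m n - x \<cdot>\<^sub>m A))"
    and "g \<equiv> (\<lambda>x. 1 / (x ^ n * poly (char_poly A) (1 / x)))"
  shows "(\<forall>x. x \<noteq> 0 \<longrightarrow> f x = g x)
    \<and> f analytic_on {0}
    \<and> fps_nth (fps_expansion f 0) d = complex_of_real (chs_norm d A ^ d)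
    \<and> remove_sings g analytic_on {0}
    \<and> fps_nth (fps_expansion (remove_sings g) 0) d = complex_of_real (chs_norm d A ^ d)"
proof -
  have A: "A \<in> carrier_mat n n"
    using assms(1) by (simp add: hermitian_mats_def)
  have fg: "f x = g x" if "x \<noteq> 0" for x
    using det_one_minus_smult[OF A that] by (simp add: f_def g_def)
  have exp_f: "f has_fps_expansion chs_fps (eigvals_desc A)"
    unfolding f_def det_one_minus_smult_eigvals[OF assms(1)]
    by (rule has_fps_expansion_inverse_linear_factors)
  then have an_f: "f analytic_on {0}"
    by (rule has_fps_expansion_imp_analytic_0)
  \<comment> \<open>At \<open>0\<close> itself \<open>g\<close> has the value \<open>1 / 0\<close>, which differs from \<open>f 0\<close> when \<open>n > 0\<close>; off \<open>0\<close> the two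
    functions agree, and limits at a point do not see the value there.\<close>
  have "remove_sings g = remove_sings f"
  proof
    fix z :: complex
    have "eventually (\<lambda>x. x \<noteq> 0) (at z)"
      by (rule eventually_neq_at_within)
    then show "remove_sings g z = remove_sings f z"
      by (intro remove_sings_cong) (auto elim!: eventually_mono simp: fg)
  qed
  moreover have "remove_sings f has_fps_expansion chs_fps (eigvals_desc A)"
    using exp_f has_fps_expansion_cong[OF eventually_remove_sings_eq_nhds[OF an_f] refl] by simp
  ultimately have exp_g: "remove_sings g has_fps_expansion chs_fps (eigvals_desc A)"
    by simp
  have "chs_norm d A ^ d = chs d (eigvals_desc A)"
    using assms(2,3) chs_nonneg_even[of d "eigvals_desc A"] by (simp add: chs_norm_def)
  then have coeff: "fps_nth (chs_fps (eigvals_desc A)) d = complex_of_real (chs_norm d A ^ d)"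
    by (simp add: chs_fps_def)
  show ?thesis
    using fg an_f coeff has_fps_expansion_imp_analytic_0[OF exp_g]
      fps_expansion_eqI[OF exp_f] fps_expansion_eqI[OF exp_g] by simp
qed

end
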